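(* As formal power series in $q$, $$\prod_{m=1}^{\infty}\frac{1}{1+q^m}=1+\sum_{l=1}^{\infty}(-1)^{l}\,\frac{q^{l^2}}{\prod_{j=1}^{l}(1-q^{2j})}.$$ *)

theory Defs
  imports
    "HOL-Analysis.Analysis"
    "HOL-Computational_Algebra.Formal_Power_Series"
begin

end

theory Submission
  imports Defs
begin

text \<open>Write $q$ for \<open>fps_X\<close>. The finite product of $(1+q^m)(1-q^{2m-1})$ over
  $m \le n$ equals that of $1-q^{n+m}$, which is $1$ modulo $q^n$; so the left-hand side is
  Euler's product of the $1-q^{2m-1}$. Put $G(z) = \sum_l (-z)^l q^{l^2} / \prod_{j\le l} (1-q^{2j})$;
  it satisfies $G(z) = (1-zq)\,G(zq^2)$, and iterating from $z = 1$ gives the same product because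
  $G(q^{2k}) \to 1$. Everything is done on partial sums, modulo powers of $q$.\<close>

lemma fps_X_power_dvd_imp_nth_eq_0:
  fixes f :: "'a::comm_ring_1 fps"
  assumes "fps_X ^ n dvd f" "i < n"
  shows "fps_nth f i = 0"
  using assms by (auto simp: fps_X_power_mult_nth elim!: dvdE)

text \<open>From n to n + 1 the right-hand side loses 1 - q^(n+1) and gains 1 - q^(2n+1) and 1 -
  q^(2n+2) = (1 - q^(n+1)) (1 + q^(n+1)). The net change is the pair of factors gained on the
  left.\<close>

lemma prod_one_plus_mult_prod_odd:
  "(\<Prod>m<n. 1 + fps_X ^ Suc m) * (\<Prod>m<n. 1 - fps_X ^ Suc (2 * m)) =
    (\<Prod>m<n. 1 - fps_X ^ Suc (n + m) :: 'a::field fps)"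
proof (induction n)
  case 0
  show ?case by simp
next
  case (Suc n)
  let ?q = "fps_X :: 'a fps"
  \<comment> \<open>Needed to cancel the lost factor: \<open>shift\<close> is stated with it on both
    sides to avoid division.\<close>
  have "fps_nth (1 - ?q ^ Suc n) 0 \<noteq> 0"
    by simp
  hence nz: "1 - ?q ^ Suc n \<noteq> 0"
    by (metis fps_zero_nth)
  have "(1 - ?q ^ Suc n) * (\<Prod>m<Suc n. 1 - ?q ^ Suc (Suc n + m)) =
      (\<Prod>m<Suc (Suc n). 1 - ?q ^ Suc (n + m))"
    by (subst (2) prod.lessThan_Suc_shift) simp
  also have "\<dots> = (\<Prod>m<n. 1 - ?q ^ Suc (n + m)) * (1 - ?q ^ Suc (2 * n)) * (1 - ?q ^ (2 * Suc n))"
    by (simp add: mult_2)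
  also have "1 - ?q ^ (2 * Suc n) = (1 - ?q ^ Suc n) * (1 + ?q ^ Suc n)"
    by (simp only: mult_2 [of "Suc n"] power_add) (simp only: algebra_simps, simp)
  finally have shift: "(1 - ?q ^ Suc n) * (\<Prod>m<Suc n. 1 - ?q ^ Suc (Suc n + m)) =
      (1 - ?q ^ Suc n) * ((\<Prod>m<n. 1 - ?q ^ Suc (n + m)) * (1 - ?q ^ Suc (2 * n)) * (1 + ?q ^ Suc n))"
    by (simp only: ac_simps)
  have "(\<Prod>m<Suc n. 1 + ?q ^ Suc m) * (\<Prod>m<Suc n. 1 - ?q ^ Suc (2 * m)) =
      ((\<Prod>m<n. 1 + ?q ^ Suc m) * (\<Prod>m<n. 1 - ?q ^ Suc (2 * m))) *
        (1 - ?q ^ Suc (2 * n)) * (1 + ?q ^ Suc n)"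
    by (simp only: prod.lessThan_Suc ac_simps)
  also have "\<dots> = (\<Prod>m<Suc n. 1 - ?q ^ Suc (Suc n + m))"
    unfolding Suc.IH using shift nz by (metis mult_left_cancel)
  finally show ?case .
qed

lemma dvd_prod_diff_one:
  fixes f :: "'b \<Rightarrow> 'a::comm_ring_1"
  assumes "\<And>i. i \<in> A \<Longrightarrow> d dvd f i - 1"
  shows "d dvd prod f A - 1"
  using assms
proof (induction A rule: infinite_finite_induct)
  case (insert x A)
  have "prod f (insert x A) - 1 = f x * (prod f A - 1) + (f x - 1)"
    using insert by (simp add: algebra_simps)
  moreover have "d dvd f x * (prod f A - 1) + (f x - 1)"
    using insert by (intro dvd_add dvd_mult) auto
  ultimately show ?case
    by (simp only:)
qed auto

text \<open>Let P be the product of reciprocals, A that of the 1 + q^m and B the odd product. As P A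
  = 1, P - B = -P (A B - 1), and A B is 1 modulo q^n.\<close>

lemma prod_inverse_cong_prod_odd:
  "fps_X ^ n dvd (\<Prod>m<n. 1 / (1 + fps_X ^ Suc m)) - (\<Prod>m<n. 1 - fps_X ^ Suc (2 * m) :: 'a::field fps)"
proof -
  let ?q = "fps_X :: 'a fps"
  let ?P = "\<Prod>m<n. 1 / (1 + ?q ^ Suc m)"
  have "1 / (1 + ?q ^ Suc m) * (1 + ?q ^ Suc m) = 1" for m
    by (subst fps_divide_unit) (auto intro: inverse_mult_eq_1)
  hence "?P * (\<Prod>m<n. 1 + ?q ^ Suc m) = 1"
    by (simp only: prod.distrib [symmetric] prod.neutral_const)
  hence "?P - (\<Prod>m<n. 1 - ?q ^ Suc (2 * m)) =
      - (?P * ((\<Prod>m<n. 1 + ?q ^ Suc m) * (\<Prod>m<n. 1 - ?q ^ Suc (2 * m)) - 1))"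
    by (simp only: right_diff_distrib mult.assoc [symmetric]) simp
  also have "\<dots> = - (?P * ((\<Prod>m<n. 1 - ?q ^ Suc (n + m)) - 1))"
    by (simp only: prod_one_plus_mult_prod_odd)
  also have "?q ^ n dvd \<dots>"
  proof -
    have "?q ^ n dvd (\<Prod>m<n. 1 - ?q ^ Suc (n + m)) - 1"
    proof (rule dvd_prod_diff_one)
      fix m
      have "?q ^ n dvd ?q ^ Suc (n + m)"
        by (rule le_imp_power_dvd) simp
      thus "?q ^ n dvd 1 - ?q ^ Suc (n + m) - 1"
        by simp
    qed
    thus ?thesis
      by simp
  qed
  finally show ?thesis .
qed

text \<open>The coefficient of z^l in G(z), sign included.\<close>

definition euler_term :: "nat \<Rightarrow> 'a::field fps" where
  "euler_term l = (- 1) ^ l * (fps_X ^ (l\<^sup>2) / (\<Prod>j=1..l. 1 - fps_X ^ (2 * j)))"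

lemma euler_term_0 [simp]: "euler_term 0 = 1"
  by (simp add: euler_term_def)

lemma euler_term_eq_inverse:
  "euler_term l = (- 1) ^ l * (fps_X ^ (l\<^sup>2) * inverse (\<Prod>j=1..l. 1 - fps_X ^ (2 * j) :: 'a::field fps))"
proof -
  have "fps_nth (\<Prod>j=1..l. 1 - fps_X ^ (2 * j) :: 'a fps) 0 = 1"
    by (induction l) auto
  thus ?thesis
    by (simp add: euler_term_def fps_divide_unit)
qed

lemma fps_X_power_dvd_euler_term: "fps_X ^ l dvd euler_term l"
proof -
  have "fps_X ^ l dvd (fps_X ^ (l\<^sup>2) :: 'a fps)"
    by (rule le_imp_power_dvd) (simp add: power2_eq_square)
  thus ?thesis
    unfolding euler_term_eq_inverse by (intro dvd_mult dvd_mult2)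
qed

text \<open>The coefficient of z^(l+1) in G(z) - G(z q^2) = -z q G(z q^2). Directly, it rests on
  (l+1)^2 - l^2 = 2l + 1 and the one new factor of the denominator.\<close>

lemma euler_term_Suc:
  "euler_term (Suc l) * (1 - fps_X ^ (2 * Suc l)) = - (fps_X ^ Suc (2 * l) * euler_term l :: 'a::field fps)"
proof -
  let ?u = "1 - fps_X ^ (2 * Suc l) :: 'a fps"
  let ?I = "inverse (\<Prod>j=1..l. 1 - fps_X ^ (2 * j) :: 'a fps)"
  have "inverse ?u * ?u = 1"
    by (rule inverse_mult_eq_1) simp
  hence "euler_term (Suc l) * ?u = (- 1) ^ Suc l * (fps_X ^ ((Suc l)\<^sup>2) * ?I)"
    by (simp add: euler_term_eq_inverse prod.nat_ivl_Suc' fps_inverse_mult del: mult_Suc_right)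
  also have "(Suc l)\<^sup>2 = Suc (2 * l) + l\<^sup>2"
    by (simp add: power2_eq_square)
  finally show ?thesis
    by (simp only: euler_term_eq_inverse power_add) (simp add: ac_simps)
qed

text \<open>A partial sum of $G(q^{2k})$.\<close>

definition euler_sum :: "nat \<Rightarrow> nat \<Rightarrow> 'a::field fps" where
  "euler_sum k n = (\<Sum>l\<le>n. euler_term l * fps_X ^ (2 * k * l))"

text \<open>The functional equation of G at z = q^(2k), truncated. Multiplying by z q shifts the
  index by one, so the sum on the right stops one earlier and its top term is left over.\<close>

lemma euler_sum_Suc:
  "euler_sum k (Suc n) =
    (1 - fps_X ^ Suc (2 * k)) * euler_sum (Suc k) n +
      euler_term (Suc n) * fps_X ^ (2 * Suc k * Suc n)"
proof -
  let ?q = "fps_X :: 'a fps"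
  have step: "euler_term (Suc l) * ?q ^ (2 * k * Suc l) =
      euler_term (Suc l) * ?q ^ (2 * Suc k * Suc l)
      - ?q ^ Suc (2 * k) * (euler_term l * ?q ^ (2 * Suc k * l))" for l
  proof -
    have "euler_term (Suc l) * ?q ^ (2 * k * Suc l) - euler_term (Suc l) * ?q ^ (2 * Suc k * Suc l)
      = euler_term (Suc l) * (1 - ?q ^ (2 * Suc l)) * ?q ^ (2 * k * Suc l)"
      by (simp add: algebra_simps flip: power_add)
    also have "\<dots> = - (?q ^ Suc (2 * k) * (euler_term l * ?q ^ (2 * Suc k * l)))"
      by (subst euler_term_Suc) (simp add: algebra_simps flip: power_add power_Suc)
    finally show ?thesis
      by (simp add: algebra_simps)
  qed
  have "euler_sum k (Suc n) = 1 + (\<Sum>l\<le>n. euler_term (Suc l) * ?q ^ (2 * k * Suc l))"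
    unfolding euler_sum_def by (subst sum.atMost_Suc_shift) simp
  also have "\<dots> = 1 + (\<Sum>l\<le>n. euler_term (Suc l) * ?q ^ (2 * Suc k * Suc l))
      - ?q ^ Suc (2 * k) * euler_sum (Suc k) n"
    by (simp only: step sum_subtractf euler_sum_def sum_distrib_left add_diff_eq)
  also have "1 + (\<Sum>l\<le>n. euler_term (Suc l) * ?q ^ (2 * Suc k * Suc l)) = euler_sum (Suc k) (Suc n)"
    unfolding euler_sum_def by (subst sum.atMost_Suc_shift) simp
  also have "\<dots> = euler_sum (Suc k) n + euler_term (Suc n) * ?q ^ (2 * Suc k * Suc n)"
    by (simp only: euler_sum_def sum.atMost_Suc)
  finally show ?thesis
    by (simp only: left_diff_distrib mult_1_left) (simp only: algebra_simps)
qed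

text \<open>Iterates \<open>euler_sum_Suc\<close> n times from k = 0. Each pass shortens the sum by
  one term, hence the start at n + m; the dropped terms have index above m, so q^(m+1) divides
  them.\<close>

lemma euler_sum_cong_prod_odd_mult:
  "fps_X ^ Suc m dvd euler_sum 0 (n + m) -
    (\<Prod>k<n. 1 - fps_X ^ Suc (2 * k)) * (euler_sum n m :: 'a::field fps)"
proof (induction n arbitrary: m)
  case (Suc n)
  let ?q = "fps_X :: 'a fps"
  let ?O = "\<lambda>n. \<Prod>k<n. 1 - ?q ^ Suc (2 * k)"
  \<comment> \<open>The hypothesis is used at \<open>Suc m\<close>, because the sum at level n has
    one more term than the sum it is reduced to.\<close>
  have "?q ^ Suc m dvd euler_sum 0 (n + Suc m) - ?O n * euler_sum n (Suc m)"
    using Suc.IH [of "Suc m"] by (rule dvd_trans [OF le_imp_power_dvd, rotated]) simp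
  moreover have "?q ^ Suc m dvd ?O n * (euler_term (Suc m) * ?q ^ (2 * Suc n * Suc m))"
    by (intro dvd_mult dvd_mult2 fps_X_power_dvd_euler_term)
  ultimately have "?q ^ Suc m dvd euler_sum 0 (n + Suc m) - ?O n * euler_sum n (Suc m)
      + ?O n * (euler_term (Suc m) * ?q ^ (2 * Suc n * Suc m))"
    by (rule dvd_add)
  also have "\<dots> = euler_sum 0 (Suc n + m) - ?O (Suc n) * euler_sum (Suc n) m"
    unfolding euler_sum_Suc [of n m] prod.lessThan_Suc
    by (simp only: add_Suc_right add_Suc distrib_left mult.assoc) simp
  finally show ?case .
qed simp

lemma euler_sum_diag_cong_1: "fps_X ^ n dvd euler_sum n n - 1"
proof -
  have "euler_sum n n - 1 = (\<Sum>l<n. euler_term (Suc l) * fps_X ^ (2 * n * Suc l) :: 'a fps)"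
    unfolding euler_sum_def lessThan_Suc_atMost [symmetric] by (subst sum.lessThan_Suc_shift) simp
  also have "fps_X ^ n dvd \<dots>"
    by (intro dvd_sum dvd_mult le_imp_power_dvd) simp
  finally show ?thesis .
qed

text \<open>Taking m = n in the iteration makes both errors, from truncation and from replacing
  \<open>euler_sum n n\<close> by 1, multiples of q^n.\<close>

lemma euler_sum_cong_prod_inverse:
  "fps_X ^ n dvd euler_sum 0 (2 * n) - (\<Prod>m<n. 1 / (1 + fps_X ^ Suc m) :: 'a::field fps)"
proof -
  let ?q = "fps_X :: 'a fps"
  let ?O = "\<Prod>k<n. 1 - ?q ^ Suc (2 * k)" and ?P = "\<Prod>m<n. 1 / (1 + ?q ^ Suc m)"
  have "?q ^ n dvd euler_sum 0 (2 * n) - ?O * euler_sum n n"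
    unfolding mult_2
    by (rule dvd_trans [OF le_imp_power_dvd euler_sum_cong_prod_odd_mult [of n n, unfolded mult_2]]) simp
  moreover have "?q ^ n dvd ?O * (euler_sum n n - 1)"
    by (rule dvd_mult [OF euler_sum_diag_cong_1])
  ultimately have "?q ^ n dvd (euler_sum 0 (2 * n) - ?O * euler_sum n n + ?O * (euler_sum n n - 1))
      - (?P - ?O)"
    using prod_inverse_cong_prod_odd [of n, where ?'a = 'a] by (blast intro: dvd_add dvd_diff)
  thus ?thesis
    by (simp add: right_diff_distrib)
qed

lemma euler_sum_0_nth_eq:
  assumes "i \<le> n"
  shows "fps_nth (euler_sum 0 n) i = fps_nth (euler_sum 0 i) i"
  using assms
proof (induction n rule: dec_induct)
  case (step n)
  thus ?case
    using fps_X_power_dvd_imp_nth_eq_0 [OF fps_X_power_dvd_euler_term, of i "Suc n"]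
    by (simp add: euler_sum_def)
qed simp

theorem theorem2:
  shows "convergent_prod (\<lambda>m. 1 / (1 + fps_X ^ Suc m) :: 'a::field fps) \<and>
    summable (\<lambda>l. (- 1) ^ Suc l *
      (fps_X ^ ((Suc l)\<^sup>2) / (\<Prod>j=1..Suc l. 1 - fps_X ^ (2 * j))) :: 'a fps) \<and>
    (\<Prod>m. 1 / (1 + fps_X ^ Suc m) :: 'a fps) =
      1 + (\<Sum>l. (- 1) ^ Suc l *
        (fps_X ^ ((Suc l)\<^sup>2) / (\<Prod>j=1..Suc l. 1 - fps_X ^ (2 * j))))"
proof -
  let ?P = "\<lambda>m. 1 / (1 + fps_X ^ Suc m) :: 'a fps"
  \<comment> \<open>The common limit of series and product: by \<open>euler_sum_0_nth_eq\<close>,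
    coefficient i of the partial sums is constant from the i-th on.\<close>
  define S :: "'a fps" where "S = Abs_fps (\<lambda>i. fps_nth (euler_sum 0 i) i)"
  have sums: "(\<lambda>l. euler_term (Suc l)) sums (S - 1)"
    unfolding sums_def
  proof (rule tendsto_fpsI)
    fix i
    show "\<forall>\<^sub>F n in sequentially. fps_nth (\<Sum>l<n. euler_term (Suc l)) i = fps_nth (S - 1) i"
      using eventually_ge_at_top [of i]
    proof eventually_elim
      case (elim n)
      have "euler_sum 0 n = 1 + (\<Sum>l<n. euler_term (Suc l) :: 'a fps)"
        unfolding euler_sum_def lessThan_Suc_atMost [symmetric] by (subst sum.lessThan_Suc_shift) simp
      hence "(\<Sum>l<n. euler_term (Suc l) :: 'a fps) = euler_sum 0 n - 1"
        by simp
      thus ?case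
        using euler_sum_0_nth_eq [OF elim, where ?'a = 'a] by (simp add: S_def)
    qed
  qed
  have lim: "(\<lambda>n. \<Prod>m\<le>n. ?P m) \<longlonglongrightarrow> S"
  proof (rule tendsto_fpsI)
    fix i
    show "\<forall>\<^sub>F n in sequentially. fps_nth (\<Prod>m\<le>n. ?P m) i = fps_nth S i"
      using eventually_ge_at_top [of i]
    proof eventually_elim
      case (elim n)
      \<comment> \<open>With n + 1 factors the congruence holds modulo q^(n+1), which covers every
        coefficient i \<le> n.\<close>
      have "fps_nth (euler_sum 0 (2 * Suc n) - (\<Prod>m<Suc n. ?P m)) i = 0"
        using elim by (intro fps_X_power_dvd_imp_nth_eq_0 [OF euler_sum_cong_prod_inverse]) simp
      moreover have "fps_nth (euler_sum 0 (2 * Suc n) :: 'a fps) i = fps_nth (euler_sum 0 i) i"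
        using elim by (intro euler_sum_0_nth_eq) simp
      ultimately show ?case
        by (simp add: S_def lessThan_Suc_atMost)
    qed
  qed
  \<comment> \<open>\<open>raw_has_prod\<close> demands a nonzero limit.\<close>
  have "fps_nth S 0 = 1"
    by (simp add: S_def euler_sum_def)
  hence "S \<noteq> 0"
    by auto
  with lim have raw: "raw_has_prod ?P 0 S"
    by (simp add: raw_has_prod_def)
  hence "?P has_prod S"
    unfolding has_prod_def by blast
  hence "prodinf ?P = S"
    by (rule has_prod_unique [symmetric])
  moreover have "convergent_prod ?P"
    unfolding convergent_prod_def using raw by blast
  moreover have "summable (\<lambda>l. euler_term (Suc l) :: 'a fps)" "(\<Sum>l. euler_term (Suc l)) = S - 1"
    using sums by (auto simp: sums_iff)
  ultimately show ?thesis
    by (simp add: euler_term_def)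
qed

end
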